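(* Let $m\ge 3$ be an odd integer. Then the number of Klein bottle equivalence classes of $C_4$-face-magic Klein bottle labelings of $\mathcal{K}_{m,4}$ (i.e. the number of Klein bottle nonequivalent such labelings) is $2^m\,(m-1)!\,\tau(m)$, where $\tau(m)$ is the number of positive divisors of $m$.
   Context: For integers $m,n\ge 2$, the $m\times n$ Klein bottle grid graph $\mathcal{K}_{m,n}$ has vertex set $\{(i,j):1\le i\le m,\ 1\le j\le n\}$ and edges $(i,j)(i,j+1)$ for $1\le j\le n-1$; $(i,n)(i,1)$; $(i,j)(i+1,j)$ for $1\le i\le m-1$; and $(m,j)(1,n+1-j)$ for $1\le j\le n$. Its $4$-cycle faces in the natural Klein bottle embedding are, with column indices modulo $n$, $\{(i,j),(i,j+1),(i+1,j),(i+1,j+1)\}$ for $1\le i\le m-1$, $1\le j\le n$, and $\{(m,j),(m,j+1),(1,n+1-j),(1,n-j)\}$ for $1\le j\le n$. A $C_4$-face-magic Klein bottle labeling is a bijection $X=\{x_{i,j}\}$ from the vertices to $\{1,\dots,mn\}$ such that all these $4$-cycle face sums are equal. For $n$ even, define the maps on vertices $U(i,j)=(i+1,j)$ for $1\le i\le m-1$, $U(m,j)=(1,n+1-j)$; $H(i,j)=(i,j+n/2)$ (column index modulo $n$); $F(i,j)=(i,n+1-j)$. Let $KBLS(m,n)=\langle U,H,F\rangle$; these are the graph automorphisms of $\mathcal{K}_{m,n}$ induced by homeomorphisms of the Klein bottle mapping the embedded graph onto itself. For $A\in KBLS(m,n)$ and a labeling $X=\{x_{i,j}\}$ let $A(X)=\{x_{A(i,j)}\}$.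 Two $C_4$-face-magic Klein bottle labelings $X,X'$ are Klein bottle equivalent if $X'=A(X)$ for some $A\in KBLS(m,n)$. *)

theory Defs
  imports "HOL-Algebra.Bij" "HOL-Algebra.Generated_Groups"
begin

definition kb_vertices :: "nat \<Rightarrow> nat \<Rightarrow> (nat \<times> nat) set" where
  "kb_vertices m n = {1..m} \<times> {1..n}"

text \<open>Column indices are read modulo \<open>n\<close> with representatives \<open>1, \<dots>, n\<close> (not \<open>0, \<dots>, n - 1\<close>).\<close>

definition kb_col :: "nat \<Rightarrow> nat \<Rightarrow> nat" where
  "kb_col n j = (if j mod n = 0 then n else j mod n)"

text \<open>A face is given by its set of vertices; these are four distinct vertices whenever
  \<open>m, n \<ge> 2\<close>.\<close>

definition kb_faces :: "nat \<Rightarrow> nat \<Rightarrow> (nat \<times> nat) set set" where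
  "kb_faces m n =
     {{(i, j), (i, kb_col n (j + 1)), (i + 1, j), (i + 1, kb_col n (j + 1))} | i j.
        1 \<le> i \<and> i \<le> m - 1 \<and> 1 \<le> j \<and> j \<le> n}
     \<union> {{(m, j), (m, kb_col n (j + 1)), (1, n + 1 - j), (1, kb_col n (n - j))} | j.
        1 \<le> j \<and> j \<le> n}"

text \<open>Labelings are extensional, so that distinct functions are distinct labelings of the
  vertices.\<close>

definition kb_labelings :: "nat \<Rightarrow> nat \<Rightarrow> (nat \<times> nat \<Rightarrow> nat) set" where
  "kb_labelings m n =
     {X \<in> extensional (kb_vertices m n).
        bij_betw X (kb_vertices m n) {1..m * n} \<and>
        (\<exists>S. \<forall>f \<in> kb_faces m n. (\<Sum>v \<in> f. X v) = S)}"

definition kb_U :: "nat \<Rightarrow> nat \<Rightarrow> nat \<times> nat \<Rightarrow> nat \<times> nat" where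
  "kb_U m n = (\<lambda>(i, j) \<in> kb_vertices m n. if i < m then (i + 1, j) else (1, n + 1 - j))"

definition kb_H :: "nat \<Rightarrow> nat \<Rightarrow> nat \<times> nat \<Rightarrow> nat \<times> nat" where
  "kb_H m n = (\<lambda>(i, j) \<in> kb_vertices m n. (i, kb_col n (j + n div 2)))"

definition kb_F :: "nat \<Rightarrow> nat \<Rightarrow> nat \<times> nat \<Rightarrow> nat \<times> nat" where
  "kb_F m n = (\<lambda>(i, j) \<in> kb_vertices m n. (i, n + 1 - j))"

text \<open>The group is meant for even \<open>n\<close> only.\<close>

definition KBLS :: "nat \<Rightarrow> nat \<Rightarrow> (nat \<times> nat \<Rightarrow> nat \<times> nat) set" where
  "KBLS m n = generate (BijGroup (kb_vertices m n)) {kb_U m n, kb_H m n, kb_F m n}"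

definition kb_act ::
    "nat \<Rightarrow> nat \<Rightarrow> (nat \<times> nat \<Rightarrow> nat \<times> nat) \<Rightarrow> (nat \<times> nat \<Rightarrow> nat) \<Rightarrow> (nat \<times> nat \<Rightarrow> nat)" where
  "kb_act m n A X = (\<lambda>v \<in> kb_vertices m n. X (A v))"

definition kb_equivalence ::
    "nat \<Rightarrow> nat \<Rightarrow> ((nat \<times> nat \<Rightarrow> nat) \<times> (nat \<times> nat \<Rightarrow> nat)) set" where
  "kb_equivalence m n =
     {(X, X'). X \<in> kb_labelings m n \<and> X' \<in> kb_labelings m n \<and>
        (\<exists>A \<in> KBLS m n. X' = kb_act m n A X)}"

lemma kb_U_in_Bij: "kb_U m n \<in> Bij (kb_vertices m n)"
proof -
  have "bij_betw (kb_U m n) (kb_vertices m n) (kb_vertices m n)"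
    by (rule bij_betw_byWitness[where f' =
          "\<lambda>(i, j). if i = 1 then (m, n + 1 - j) else (i - 1, j)"])
       (auto simp: kb_U_def kb_vertices_def split: if_splits)
  thus ?thesis by (auto simp: Bij_def kb_U_def)
qed

lemma kb_F_in_Bij: "kb_F m n \<in> Bij (kb_vertices m n)"
proof -
  have "bij_betw (kb_F m n) (kb_vertices m n) (kb_vertices m n)"
    by (rule bij_betw_byWitness[where f' = "\<lambda>(i, j). (i, n + 1 - j)"])
       (auto simp: kb_F_def kb_vertices_def)
  thus ?thesis by (auto simp: Bij_def kb_F_def)
qed

lemma kb_col_shift:
  assumes "even n" "1 \<le> j" "j \<le> n"
  shows "kb_col n (j + n div 2) = (if j \<le> n div 2 then j + n div 2 else j - n div 2)"
proof -
  obtain k where k: "n = 2 * k" using assms(1) by blast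
  show ?thesis
  proof (cases "j \<le> k")
    case True
    thus ?thesis using assms k by (cases "j = k") (auto simp: kb_col_def mult_2[symmetric])
  next
    case False
    hence "j + k = (j - k) + n" "j - k < n" using assms k by auto
    hence "(j + k) mod n = j - k" by (metis mod_add_self2 mod_less)
    thus ?thesis using False k by (simp add: kb_col_def)
  qed
qed

lemma kb_H_in_Bij:
  assumes "even n"
  shows "kb_H m n \<in> Bij (kb_vertices m n)"
proof -
  have "bij_betw (kb_H m n) (kb_vertices m n) (kb_vertices m n)"
    using assms
    by (intro bij_betw_byWitness[where f' =
          "\<lambda>(i, j). (i, if j \<le> n div 2 then j + n div 2 else j - n div 2)"])
       (auto simp: kb_H_def kb_vertices_def kb_col_shift)
  thus ?thesis by (auto simp: Bij_def kb_H_def)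
qed

lemma equiv_kb_equivalence:
  assumes "even n"
  shows "equiv (kb_labelings m n) (kb_equivalence m n)"
proof -
  let ?V = "kb_vertices m n"
  interpret B: group "BijGroup ?V" by (rule group_BijGroup)
  have gens: "{kb_U m n, kb_H m n, kb_F m n} \<subseteq> carrier (BijGroup ?V)"
    using kb_U_in_Bij kb_F_in_Bij kb_H_in_Bij[OF assms] by (auto simp: BijGroup_def)
  have sub: "subgroup (KBLS m n) (BijGroup ?V)"
    unfolding KBLS_def by (rule B.generate_is_subgroup[OF gens])
  have Bij: "A \<in> Bij ?V" if "A \<in> KBLS m n" for A
    using subgroup.mem_carrier[OF sub that] by (simp add: BijGroup_def)
  have V: "A v \<in> ?V" if "A \<in> KBLS m n" "v \<in> ?V" for A v
    using Bij[OF that(1)] that(2) by (auto simp: Bij_def bij_betw_def)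
  have one: "(\<lambda>v \<in> ?V. v) \<in> KBLS m n"
    using subgroup.one_closed[OF sub] by (simp add: BijGroup_def)
  have comp: "compose ?V A B \<in> KBLS m n" if "A \<in> KBLS m n" "B \<in> KBLS m n" for A B
    using subgroup.m_closed[OF sub that] Bij[OF that(1)] Bij[OF that(2)]
    by (simp add: BijGroup_def)
  have inv: "\<exists>B \<in> KBLS m n. \<forall>v \<in> ?V. A (B v) = v" if "A \<in> KBLS m n" for A
  proof
    let ?B = "inv\<^bsub>BijGroup ?V\<^esub> A"
    show B: "?B \<in> KBLS m n" by (rule subgroup.m_inv_closed[OF sub that])
    have "A \<otimes>\<^bsub>BijGroup ?V\<^esub> ?B = \<one>\<^bsub>BijGroup ?V\<^esub>"
      using subgroup.mem_carrier[OF sub that] by simp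
    hence "compose ?V A ?B = (\<lambda>v \<in> ?V. v)"
      using Bij[OF that] Bij[OF B] by (simp add: BijGroup_def)
    thus "\<forall>v \<in> ?V. A (?B v) = v" by (metis compose_eq restrict_apply')
  qed
  have act_one: "kb_act m n (\<lambda>v \<in> ?V. v) X = X" if "X \<in> kb_labelings m n" for X
    using that by (auto simp: kb_act_def kb_labelings_def extensional_def fun_eq_iff)
  show ?thesis
  proof (rule equivI)
    show "kb_equivalence m n \<subseteq> kb_labelings m n \<times> kb_labelings m n"
      by (auto simp: kb_equivalence_def)
    show "refl_on (kb_labelings m n) (kb_equivalence m n)"
    proof (rule refl_onI)
      fix X assume X: "X \<in> kb_labelings m n"
      have "\<exists>A \<in> KBLS m n. X = kb_act m n A X"
        using one act_one[OF X] by (intro bexI[of _ "\<lambda>v \<in> ?V. v"]) simp_all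
      thus "(X, X) \<in> kb_equivalence m n" using X by (simp add: kb_equivalence_def)
    qed
    show "sym (kb_equivalence m n)"
    proof (rule symI)
      fix X Y assume "(X, Y) \<in> kb_equivalence m n"
      then obtain A where A: "X \<in> kb_labelings m n" "Y \<in> kb_labelings m n"
        "A \<in> KBLS m n" "Y = kb_act m n A X" by (auto simp: kb_equivalence_def)
      obtain B where B: "B \<in> KBLS m n" "\<forall>v \<in> ?V. A (B v) = v" using inv[OF A(3)] by blast
      have "kb_act m n B Y = kb_act m n (\<lambda>v \<in> ?V. v) X"
        unfolding A(4) kb_act_def using B V by (intro restrict_ext) simp
      hence "X = kb_act m n B Y" using act_one[OF A(1)] by simp
      thus "(Y, X) \<in> kb_equivalence m n" using A B by (auto simp: kb_equivalence_def)
    qed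
    show "trans (kb_equivalence m n)"
    proof (rule transI)
      fix X Y Z assume "(X, Y) \<in> kb_equivalence m n" "(Y, Z) \<in> kb_equivalence m n"
      then obtain A B where AB: "X \<in> kb_labelings m n" "Z \<in> kb_labelings m n"
        "A \<in> KBLS m n" "Y = kb_act m n A X" "B \<in> KBLS m n" "Z = kb_act m n B Y"
        by (auto simp: kb_equivalence_def)
      have "Z = kb_act m n (compose ?V A B) X"
        unfolding AB(4,6) kb_act_def using AB V by (intro restrict_ext) (simp add: compose_def)
      thus "(X, Z) \<in> kb_equivalence m n" using AB comp by (auto simp: kb_equivalence_def)
    qed
  qed
qed

end

theory Submission
  imports Defs
begin

text \<open>For odd \<open>m\<close> the face sums force a rigid shape. With \<open>M = 4 m + 1\<close> there is an integer \<open>D\<close> such that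
  every odd row reads \<open>a, M + D - a, a - D, M - a\<close> and every even row is such a row reversed. Let \<open>T\<close>
  be the set of the \<open>2 m\<close> labels of the form \<open>a\<close> or \<open>M + D - a\<close>. The other labels form \<open>T - D\<close>, so \<open>T\<close>
  and \<open>T - D\<close> tile \<open>{1..4 m}\<close>. Such a tiling exists iff \<open>D\<close> divides \<open>2 m\<close>, and then \<open>T\<close> consists of
  alternate blocks of length \<open>\<bar>D\<bar>\<close>. As \<open>m\<close> is odd there are \<open>4 \<tau>(m)\<close> such \<open>D\<close>, and \<open>x \<mapsto> M + D - x\<close> is a
  fixed-point-free involution of \<open>T\<close>, so for each \<open>D\<close> there are \<open>2\<^sup>m m!\<close> choices of the sequence of the
  \<open>a\<close>. Finally, \<open>KBLS m 4\<close> is abelian and acts transitively, hence regularly, on the \<open>4 m\<close> vertices, so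
  every equivalence class has \<open>4 m\<close> elements.\<close>

section \<open>Tilings of an interval by two translates\<close>

text \<open>Blocks of length \<open>\<bar>D\<bar>\<close> are numbered from 0. The odd ones are kept
  for \<open>D > 0\<close>, the even ones for \<open>D < 0\<close>, so that translation by
  \<open>-D\<close> leads to the other kind.\<close>

definition stripes :: "int \<Rightarrow> int \<Rightarrow> int set" where
  "stripes N D = {x \<in> {1..N}. odd ((x - 1) div \<bar>D\<bar>) \<longleftrightarrow> D > 0}"

lemma div_diff_self: "(x - D) div D = x div D - 1" if "D \<noteq> 0" for x D :: int
  using div_mult_self1[OF that, of x "-1"] by simp

text \<open>A greedy argument from below: the first \<open>D\<close> numbers cannot be in
  \<open>B\<close>, and afterwards membership alternates with period \<open>D\<close>. The upper end
  then forces an even number of complete blocks.\<close>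

lemma shift_tiling_blocks:
  fixes A B :: "int set" and D N :: int
  assumes un: "A \<union> B = {1..N}" and disj: "A \<inter> B = {}" and sh: "B = (\<lambda>x. x + D) ` A"
    and D: "D > 0" and N: "N > 0"
  shows "2 * D dvd N" and "A = {x \<in> {1..N}. even ((x - 1) div D)}"
proof -
  have mem: "x \<in> A \<longleftrightarrow> even ((x - 1) div D)" if "x \<in> {1..N}" for x
    using that
  proof (induction "nat x" arbitrary: x rule: less_induct)
    case less
    have x: "x \<in> A \<or> x \<in> B" using less.prems un by blast
    have B_iff: "x \<in> B \<longleftrightarrow> x - D \<in> A" unfolding sh by force
    show ?case
    proof (cases "x \<le> D")
      case True
      have "x - D \<notin> {1..N}" using True by simp
      hence "x - D \<notin> A" using un by blast
      moreover have "(x - 1) div D = 0" using True less.prems by simp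
      ultimately show ?thesis using x B_iff by simp
    next
      case False
      have "x - D \<in> A \<longleftrightarrow> even ((x - D - 1) div D)"
        using less.hyps[of "x - D"] False less.prems D by auto
      moreover have "(x - D - 1) div D = (x - 1) div D - 1"
        using div_diff_self[of D "x - 1"] D by (simp add: algebra_simps)
      ultimately show ?thesis using x B_iff disj by auto
    qed
  qed
  thus A: "A = {x \<in> {1..N}. even ((x - 1) div D)}" using un by blast
  have A_le: "x + D \<le> N" if "x \<in> A" for x using that un sh by fastforce
  have "1 \<in> A" using mem[of 1] N by simp
  hence DN: "D < N" using A_le[of 1] by simp
  \<comment> \<open>Nothing above \<open>N - D\<close> is in \<open>A\<close>. The two ends
    \<open>N\<close> and \<open>N - D + 1\<close> of this range give opposite parities for
    \<open>(N - 1) div D\<close> and \<open>N div D\<close>, which would be equal if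
    \<open>D\<close> did not divide \<open>N\<close>.\<close>
  have "N \<notin> A" using A_le[of N] D by auto
  hence 1: "odd ((N - 1) div D)" using mem[of N] N by auto
  have "N - D + 1 \<notin> A" using A_le[of "N - D + 1"] by auto
  hence "odd ((N - D) div D)" using mem[of "N - D + 1"] DN D by auto
  hence 2: "even (N div D)" using div_diff_self[of D N] D by auto
  have "D dvd N"
  proof (rule ccontr)
    assume "\<not> D dvd N"
    hence "0 < N mod D" using D by (simp add: dvd_eq_mod_eq_0 order_less_le)
    moreover have "N - 1 = D * (N div D) + (N mod D - 1)" by simp
    moreover have "N mod D < D" using D by simp
    ultimately have "(N - 1) div D = N div D"
      using int_div_pos_eq[of "N - 1" D "N div D" "N mod D - 1"] by linarith
    thus False using 1 2 by simp
  qed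
  then obtain q where q: "N = D * q" by blast
  hence "even q" using 2 D by simp
  thus "2 * D dvd N" using q by auto
qed

text \<open>The blocks pair up: each even block is followed by an odd one that still lies inside the
  interval.\<close>

lemma blocks_shift:
  fixes D N :: int
  assumes "D > 0" "2 * D dvd N"
  shows "{x \<in> {1..N}. odd ((x - 1) div D)} = (\<lambda>x. x + D) ` {x \<in> {1..N}. even ((x - 1) div D)}"
    (is "?B = _ ` ?A")
proof -
  obtain k where k: "N = 2 * D * k" using assms(2) by blast
  have sh: "(x + D - 1) div D = (x - 1) div D + 1" for x
    using div_diff_self[of D "x + D - 1"] assms(1) by (simp add: algebra_simps)
  have "x + D \<le> N" if "x \<in> ?A" for x
  proof (rule ccontr)
    assume "\<not> x + D \<le> N"
    \<comment> \<open>An overshooting \<open>x\<close> would lie in the last block, whose number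
      \<open>2 * k - 1\<close> is odd.\<close>
    hence "x - 1 = D * (2 * k - 1) + (x - 1 - (N - D))" "0 \<le> x - 1 - (N - D)" "x - 1 - (N - D) < D"
      using that by (auto simp: k algebra_simps)
    hence "(x - 1) div D = 2 * k - 1" by (rule int_div_pos_eq)
    thus False using that by simp
  qed
  hence "(\<lambda>x. x + D) ` ?A \<subseteq> ?B" using sh assms(1) by auto
  moreover have "x \<in> (\<lambda>x. x + D) ` ?A" if "x \<in> ?B" for x
  proof
    show "x = x - D + D" by simp
    have "x > D"
    proof (rule ccontr)
      assume "\<not> x > D"
      hence "(x - 1) div D = 0" using that by simp
      thus False using that by simp
    qed
    thus "x - D \<in> ?A" using that sh[of "x - D"] assms(1) by auto
  qed
  ultimately show ?thesis by blast
qed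

text \<open>The lower of the two translates plays \<open>A\<close> in
  \<open>shift_tiling_blocks\<close>: the shifted copy of \<open>T\<close> if \<open>D > 0\<close>,
  and \<open>T\<close> itself if \<open>D < 0\<close>. For \<open>D = 0\<close> both sides fail
  because \<open>N > 0\<close>.\<close>

lemma shift_tiling_iff:
  fixes N D :: int
  assumes N: "N > 0"
  shows "T \<union> (\<lambda>x. x - D) ` T = {1..N} \<and> T \<inter> (\<lambda>x. x - D) ` T = {}
     \<longleftrightarrow> 2 * D dvd N \<and> T = stripes N D" (is "?L \<longleftrightarrow> ?R")
proof (cases D "0 :: int" rule: linorder_cases)
  case equal
  thus ?thesis using N by auto
next
  case greater
  let ?B = "(\<lambda>x. x - D) ` T"
  have T: "T = (\<lambda>x. x + D) ` ?B" by (auto simp: image_image)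
  show ?thesis
  proof
    assume L: ?L
    have "?B \<union> T = {1..N}" "?B \<inter> T = {}" using L by (simp_all add: Un_commute Int_commute)
    from shift_tiling_blocks[OF this T greater N]
    have "2 * D dvd N" "?B = {x \<in> {1..N}. even ((x - 1) div D)}" .
    moreover have "T = {1..N} - ?B" using L by blast
    ultimately show ?R using greater by (auto simp: stripes_def)
  next
    assume R: ?R
    hence S: "T = {x \<in> {1..N}. odd ((x - 1) div D)}" using greater by (auto simp: stripes_def)
    have "?B = (\<lambda>x. x - D) ` (\<lambda>x. x + D) ` {x \<in> {1..N}. even ((x - 1) div D)}"
      using blocks_shift[of D N] R S greater by simp
    hence "?B = {x \<in> {1..N}. even ((x - 1) div D)}" by (simp add: image_image)
    thus ?L unfolding S by auto
  qed
next
  case less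
  let ?B = "(\<lambda>x. x - D) ` T"
  have B: "?B = (\<lambda>x. x + - D) ` T" by simp
  show ?thesis
  proof
    assume L: ?L
    hence "T \<union> ?B = {1..N}" "T \<inter> ?B = {}" by simp_all
    from shift_tiling_blocks[OF this B _ N] less
    have "2 * - D dvd N" "T = {x \<in> {1..N}. even ((x - 1) div - D)}" by simp_all
    thus ?R using less by (auto simp: stripes_def)
  next
    assume R: ?R
    hence S: "T = {x \<in> {1..N}. even ((x - 1) div - D)}" using less by (auto simp: stripes_def)
    have "?B = {x \<in> {1..N}. odd ((x - 1) div - D)}"
      using blocks_shift[of "- D" N] R S less by simp
    thus ?L unfolding S by auto
  qed
qed

lemma stripes_tiling:
  assumes "N > 0" "2 * D dvd N"
  shows "stripes N D \<union> (\<lambda>x. x - D) ` stripes N D = {1..N}"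
    and "stripes N D \<inter> (\<lambda>x. x - D) ` stripes N D = {}"
  using shift_tiling_iff[OF assms(1), of "stripes N D" D] assms(2) by auto

lemma finite_stripes: "finite (stripes N D)"
  by (rule finite_subset[of _ "{1..N}"]) (auto simp: stripes_def)

lemma card_stripes:
  assumes "N > 0" "2 * D dvd N"
  shows "2 * card (stripes N D) = nat N"
proof -
  have "nat N = card (stripes N D \<union> (\<lambda>x. x - D) ` stripes N D)"
    using stripes_tiling(1)[OF assms] by simp
  also have "\<dots> = card (stripes N D) + card ((\<lambda>x. x - D) ` stripes N D)"
    using stripes_tiling(2)[OF assms] finite_stripes by (intro card_Un_disjoint) auto
  also have "card ((\<lambda>x. x - D) ` stripes N D) = card (stripes N D)"
    by (intro card_image) (auto simp: inj_on_def)
  finally show ?thesis by simp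
qed

text \<open>The mirror image \<open>N + 1 - x\<close> lies in a block of opposite parity, since the
  number of blocks is even. It is thus in the translate of the stripes by \<open>-D\<close>, and
  adding \<open>D\<close> brings it back.\<close>

lemma stripes_reflect:
  assumes N: "N > 0" "2 * D dvd N" and x: "x \<in> stripes N D"
  shows "N + 1 + D - x \<in> stripes N D"
proof -
  have D: "D \<noteq> 0" using N by auto
  let ?E = "\<bar>D\<bar>" and ?y = "N + 1 - x"
  define q where "q = (x - 1) div ?E"
  define r where "r = (x - 1) mod ?E"
  have r: "0 \<le> r" "r < ?E" using D by (auto simp: r_def)
  have xq: "x - 1 = ?E * q + r" by (simp add: q_def r_def)
  have "2 * ?E dvd N" using N(2) by (auto simp: abs_if)
  then obtain k where k: "N = 2 * ?E * k" by blast
  have "?y - 1 = ?E * (2 * k - 1 - q) + (?E - 1 - r)" using xq k by (simp add: algebra_simps)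
  hence "(?y - 1) div ?E = 2 * k - 1 - q" by (rule int_div_pos_eq) (use r in auto)
  hence "even ((?y - 1) div ?E) \<longleftrightarrow> odd ((x - 1) div ?E)" by (simp add: q_def)
  hence "?y \<in> {1..N}" "?y \<notin> stripes N D" using x by (auto simp: stripes_def)
  hence "?y \<in> (\<lambda>x. x - D) ` stripes N D" using stripes_tiling(1)[OF N] by blast
  thus ?thesis by (auto simp: algebra_simps)
qed

text \<open>A fixed point makes \<open>D\<close> odd, so \<open>\<bar>D\<bar>\<close> divides
  \<open>m\<close> and a block ends at \<open>2 * m\<close>. The fixed point would be the middle of
  the block just above (\<open>D > 0\<close>) or just below (\<open>D < 0\<close>) this boundary,
  and that block has the parity which \<open>stripes\<close> omits.\<close>

lemma stripes_reflect_neq: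
  fixes m D :: int
  assumes m: "m > 0" "odd m" and dvd: "D dvd 2 * m" and x: "x \<in> stripes (4 * m) D"
  shows "4 * m + 1 + D - x \<noteq> x"
proof
  assume eq: "4 * m + 1 + D - x = x"
  let ?E = "\<bar>D\<bar>"
  have "D = 2 * (x - 2 * m) - 1" using eq by simp
  hence "odd D" by simp
  hence "coprime D 2" by simp
  hence "?E dvd m" using dvd by (simp add: coprime_dvd_mult_right_iff)
  then obtain k where k: "m = ?E * k" by blast
  have "odd ?E" using \<open>odd D\<close> by simp
  then obtain h where h: "?E = 2 * h + 1" by (elim oddE)
  have h0: "h \<ge> 0" using h by simp
  show False
  proof (cases "D > 0")
    case True
    have "x - 1 = 2 * m + h" using eq h True by simp
    also have "\<dots> = ?E * (2 * k) + h" using k by simp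
    finally have "(x - 1) div ?E = 2 * k" by (rule int_div_pos_eq) (use h h0 in auto)
    thus False using x True by (simp add: stripes_def)
  next
    case False
    have "x - 1 = 2 * m - h - 1" using eq h False by simp
    also have "\<dots> = 2 * m - ?E + h" using h by simp
    also have "\<dots> = ?E * (2 * k - 1) + h" using k by (simp add: algebra_simps)
    finally have "(x - 1) div ?E = 2 * k - 1" by (rule int_div_pos_eq) (use h h0 in auto)
    thus False using x False by (simp add: stripes_def)
  qed
qed

text \<open>Each divisor is uniquely \<open>d * s\<close> with \<open>d\<close> a positive divisor
  of \<open>m\<close> and \<open>s\<close> one of 1, 2, -1, -2. As \<open>d\<close> is odd and
  positive, the parity and the sign of the product determine \<open>s\<close>.\<close>

lemma card_int_divisors_double_odd:
  fixes m :: nat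
  assumes "odd m"
  shows "finite {D :: int. D dvd 2 * int m}"
    and "card {D :: int. D dvd 2 * int m} = 4 * card {d. d dvd m}"
proof -
  let ?f = "\<lambda>(d, s). int d * s" and ?S = "{1, 2, -1, -2 :: int}"
  have m: "m > 0" using assms by (cases m) auto
  have fin: "finite {d. d dvd m}" using m by simp
  have pos: "d > 0" if "d dvd m" for d using that m by (auto intro: gr0I)
  have oddd: "odd d" if "d dvd m" for d using that assms by (meson dvd_trans)
  have inj: "inj_on ?f ({d. d dvd m} \<times> ?S)"
  proof (rule inj_onI)
    fix u v assume u: "u \<in> {d. d dvd m} \<times> ?S" and v: "v \<in> {d. d dvd m} \<times> ?S" and eq: "?f u = ?f v"
    obtain d s d' s' where uv: "u = (d, s)" "v = (d', s')" by (cases u, cases v) auto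
    have "d > 0" "d' > 0" "odd d" "odd d'" using u v uv pos oddd by auto
    moreover have "even s = even s'" using eq \<open>odd d\<close> \<open>odd d'\<close> unfolding uv
      by (metis case_prod_conv even_mult_iff even_of_nat)
    moreover have "sgn s = sgn s'" using eq \<open>d > 0\<close> \<open>d' > 0\<close> unfolding uv
      by (metis case_prod_conv mult_1 of_nat_0_less_iff sgn_mult sgn_pos)
    ultimately have "s = s'" using u v uv by auto
    moreover have "s \<noteq> 0" using u uv by auto
    ultimately show "u = v" using eq uv by simp
  qed
  have img: "?f ` ({d. d dvd m} \<times> ?S) = {D. D dvd 2 * int m}"
  proof (intro equalityI subsetI)
    fix D assume "D \<in> ?f ` ({d. d dvd m} \<times> ?S)"
    then obtain d s where ds: "D = int d * s" "d dvd m" "s \<in> ?S" by auto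
    have "int d * s dvd int m * 2" using ds by (intro mult_dvd_mono) auto
    thus "D \<in> {D. D dvd 2 * int m}" using ds by (simp add: mult.commute)
  next
    fix D assume "D \<in> {D. D dvd 2 * int m}"
    hence D: "D dvd 2 * int m" by simp
    hence D0: "D \<noteq> 0" using m by auto
    show "D \<in> ?f ` ({d. d dvd m} \<times> ?S)"
    proof (cases "even D")
      case False
      hence "coprime D 2" by simp
      hence "D dvd int m" using D by (simp add: coprime_dvd_mult_right_iff)
      hence "nat \<bar>D\<bar> dvd m" by (simp add: nat_abs_dvd_iff)
      thus ?thesis using D0 by (intro image_eqI[of _ _ "(nat \<bar>D\<bar>, sgn D)"]) (auto simp: sgn_if)
    next
      case True
      then obtain e where e: "D = 2 * e" by blast
      hence "e dvd int m" using D by simp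
      hence "nat \<bar>e\<bar> dvd m" by (simp add: nat_abs_dvd_iff)
      thus ?thesis using D0 e
        by (intro image_eqI[of _ _ "(nat \<bar>e\<bar>, 2 * sgn e)"]) (auto simp: sgn_if)
    qed
  qed
  show "finite {D :: int. D dvd 2 * int m}" using fin by (simp flip: img)
  have "card {D :: int. D dvd 2 * int m} = card ({d. d dvd m} \<times> ?S)"
    using card_image[OF inj] img by simp
  thus "card {D :: int. D dvd 2 * int m} = 4 * card {d. d dvd m}"
    by (simp add: card_cartesian_product)
qed

section \<open>Transversals of an involution\<close>

text \<open>For an involution \<open>f\<close>, the entries lie in pairwise different orbits
  \<open>{x, f x}\<close>. If \<open>f\<close> has no fixed point in \<open>T\<close> and
  \<open>T\<close> is twice as large as a finite \<open>I\<close>, this is an arrangement of all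
  orbits with a representative picked from each.\<close>

definition transversals :: "'i set \<Rightarrow> 'a set \<Rightarrow> ('a \<Rightarrow> 'a) \<Rightarrow> ('i \<Rightarrow> 'a) set" where
  "transversals I T f =
     {a \<in> I \<rightarrow>\<^sub>E T. \<forall>i\<in>I. \<forall>j\<in>I. i \<noteq> j \<longrightarrow> a i \<noteq> a j \<and> a i \<noteq> f (a j)}"

text \<open>One entry \<open>t\<close> can be any element of \<open>T\<close>; the others form a
  transversal of \<open>T - {t, f t}\<close>, on which \<open>f\<close> is again a fixed-point-free
  involution. The count is thus a product of consecutive even numbers.\<close>

lemma card_transversals:
  assumes "finite I" "finite T" "card T = 2 * card I"
    and "\<And>x. x \<in> T \<Longrightarrow> f x \<in> T" "\<And>x. x \<in> T \<Longrightarrow> f (f x) = x" "\<And>x. x \<in> T \<Longrightarrow> f x \<noteq> x"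
  shows "card (transversals I T f) = 2 ^ card I * fact (card I)"
  using assms
proof (induction I arbitrary: T rule: finite_induct)
  case empty
  thus ?case by (simp add: transversals_def)
next
  case (insert i I)
  note T = insert.prems
  let ?R = "\<lambda>t. transversals I (T - {t, f t}) f"
  let ?g = "\<lambda>(t, a). a(i := t)"
  have cardR: "card (?R t) = 2 ^ card I * fact (card I)" if t: "t \<in> T" for t
  proof (rule insert.IH)
    have "card {t, f t} = 2" using T(5)[OF t] by (metis card_2_iff)
    thus "card (T - {t, f t}) = 2 * card I"
      using T t insert.hyps by (subst card_Diff_subset) auto
    show "f x \<in> T - {t, f t}" if "x \<in> T - {t, f t}" for x
    proof -
      have "f x \<noteq> t" "f x \<noteq> f t" using that T(4)[of x] T(4)[OF t] by auto
      thus ?thesis using that T(3) by blast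
    qed
  qed (use T in auto)
  have finR: "finite (?R t)" for t
  proof (rule finite_subset)
    show "?R t \<subseteq> I \<rightarrow>\<^sub>E T" by (auto simp: transversals_def PiE_def)
    show "finite (I \<rightarrow>\<^sub>E T)" using insert.hyps T(1) by (simp add: finite_PiE)
  qed
  have "bij_betw ?g (Sigma T ?R) (transversals (insert i I) T f)"
  proof (rule bij_betw_byWitness[where f' = "\<lambda>a. (a i, restrict a I)"])
    show "\<forall>u\<in>Sigma T ?R. (?g u i, restrict (?g u) I) = u"
      using insert.hyps by (auto simp: transversals_def fun_eq_iff PiE_def extensional_def)
    show "\<forall>a\<in>transversals (insert i I) T f. ?g (a i, restrict a I) = a"
      by (auto simp: transversals_def fun_eq_iff PiE_def extensional_def)
    show "?g ` Sigma T ?R \<subseteq> transversals (insert i I) T f"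
    proof clarify
      fix t a assume t: "t \<in> T" and a: "a \<in> ?R t"
      have aT: "a j \<in> T" "a j \<noteq> t" "a j \<noteq> f t" if "j \<in> I" for j
        using that a by (auto simp: transversals_def)
      have "t \<noteq> f (a j)" if "j \<in> I" for j using aT[OF that] T(4) by metis
      thus "a(i := t) \<in> transversals (insert i I) T f"
        using t a aT insert.hyps
        by (auto simp: transversals_def PiE_def Pi_def extensional_def)
    qed
    show "(\<lambda>a. (a i, restrict a I)) ` transversals (insert i I) T f \<subseteq> Sigma T ?R"
    proof
      fix u assume "u \<in> (\<lambda>a. (a i, restrict a I)) ` transversals (insert i I) T f"
      then obtain a where u: "u = (a i, restrict a I)" and a: "a \<in> transversals (insert i I) T f"
        by blast
      have aT: "a j \<in> T" if "j \<in> insert i I" for j using a that by (auto simp: transversals_def)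
      have d: "a j \<noteq> a k \<and> a j \<noteq> f (a k)" if "j \<in> insert i I" "k \<in> insert i I" "j \<noteq> k" for j k
        using a that unfolding transversals_def by blast
      have "a j \<noteq> a i \<and> a j \<noteq> f (a i)" if "j \<in> I" for j using d[of j i] that insert.hyps by auto
      hence "restrict a I \<in> ?R (a i)" using aT d by (auto simp: transversals_def)
      thus "u \<in> Sigma T ?R" using u aT by simp
    qed
  qed
  hence "card (transversals (insert i I) T f) = card (Sigma T ?R)"
    by (simp add: bij_betw_same_card)
  also have "\<dots> = (\<Sum>t\<in>T. card (?R t))" using T(1) finR by (simp add: card_SigmaI)
  also have "\<dots> = card T * (2 ^ card I * fact (card I))" using cardR by simp
  also have "\<dots> = 2 ^ card (insert i I) * fact (card (insert i I))"
    using T(2) insert.hyps by (simp add: algebra_simps)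
  finally show ?case .
qed

section \<open>The action of the symmetry group\<close>

lemma kb_vertices_4: "v \<in> kb_vertices m 4 \<longleftrightarrow>
    (\<exists>i\<in>{1..m}. v = (i, 1) \<or> v = (i, 2) \<or> v = (i, 3) \<or> v = (i, 4))"
proof -
  have "{1..4} = {1, 2, 3, 4 :: nat}" by auto
  thus ?thesis unfolding kb_vertices_def by auto
qed

lemma kb_H_4:
  assumes "i \<in> {1..m}"
  shows "kb_H m 4 (i, 1) = (i, 3)" "kb_H m 4 (i, 2) = (i, 4)"
    "kb_H m 4 (i, 3) = (i, 1)" "kb_H m 4 (i, 4) = (i, 2)"
  using assms by (auto simp: kb_H_def kb_vertices_def kb_col_def)

text \<open>The orbit of \<open>(1, 1)\<close> under \<open>kb_U\<close> runs through columns 1 and 4, and \<open>kb_H\<close> maps these to 3 and 2.\<close>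

lemma kb_vertices_induct:
  assumes m: "m \<ge> 1" and v: "v \<in> kb_vertices m 4" and one: "P (1, 1)"
    and U: "\<And>v. v \<in> kb_vertices m 4 \<Longrightarrow> P v \<Longrightarrow> P (kb_U m 4 v)"
    and H: "\<And>v. v \<in> kb_vertices m 4 \<Longrightarrow> P v \<Longrightarrow> P (kb_H m 4 v)"
  shows "P v"
proof -
  have step: "P (i, j)" if "P (1, j)" "j \<in> {1..4}" "1 \<le> i" "i \<le> m" for i j
    using that(3,4)
  proof (induction i rule: dec_induct)
    case base show ?case by (rule that(1))
  next
    case (step i)
    thus ?case using U[of "(i, j)"] that(2) by (auto simp: kb_U_def kb_vertices_def)
  qed
  have "P (m, 1)" using step[of 1 m] one m by simp
  hence "P (1, 4)" using U[of "(m, 1)"] m by (auto simp: kb_U_def kb_vertices_def)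
  hence c: "P (i, 1)" "P (i, 4)" if "i \<in> {1..m}" for i
    using step[of 1 i] step[of 4 i] one that by auto
  hence "P (i, 3)" "P (i, 2)" if "i \<in> {1..m}" for i
    using H[of "(i, 1)"] H[of "(i, 4)"] kb_H_4[OF that] that by (auto simp: kb_vertices_def)
  thus ?thesis using v c unfolding kb_vertices_4 by blast
qed

context
  fixes m :: nat
  assumes m: "m \<ge> 1"
begin

private abbreviation (input) "V \<equiv> kb_vertices m 4"
private abbreviation (input) "gens \<equiv> {kb_U m 4, kb_H m 4, kb_F m 4}"

lemma gens_Bij: "gens \<subseteq> Bij V"
  using kb_U_in_Bij kb_H_in_Bij kb_F_in_Bij by auto

lemma subgroup_KBLS: "subgroup (KBLS m 4) (BijGroup V)"
  unfolding KBLS_def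
  by (rule group.generate_is_subgroup[OF group_BijGroup]) (use gens_Bij in \<open>simp add: BijGroup_def\<close>)

lemma KBLS_Bij: "A \<in> KBLS m 4 \<Longrightarrow> A \<in> Bij V"
  using subgroup.mem_carrier[OF subgroup_KBLS] by (simp add: BijGroup_def)

lemma KBLS_mem: "A \<in> KBLS m 4 \<Longrightarrow> v \<in> V \<Longrightarrow> A v \<in> V"
  using KBLS_Bij by (auto simp: Bij_def bij_betw_def)

lemma gens_KBLS: "gens \<subseteq> KBLS m 4"
  unfolding KBLS_def by (auto intro: generate.incl)

lemma KBLS_compose: "A \<in> KBLS m 4 \<Longrightarrow> B \<in> KBLS m 4 \<Longrightarrow> compose V A B \<in> KBLS m 4"
  using subgroup.m_closed[OF subgroup_KBLS, of A B] KBLS_Bij by (simp add: BijGroup_def)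

lemma KBLS_one: "(\<lambda>v\<in>V. v) \<in> KBLS m 4"
  using subgroup.one_closed[OF subgroup_KBLS] by (simp add: BijGroup_def)

lemma BijGroup_inv:
  assumes "A \<in> Bij V" "v \<in> V"
  shows "(inv\<^bsub>BijGroup V\<^esub> A) v \<in> V" "A ((inv\<^bsub>BijGroup V\<^esub> A) v) = v" "(inv\<^bsub>BijGroup V\<^esub> A) (A v) = v"
proof -
  have inv: "inv\<^bsub>BijGroup V\<^esub> A = (\<lambda>x\<in>V. inv_into V A x)"
    by (rule inv_BijGroup[OF assms(1)])
  have b: "bij_betw A V V" using assms(1) by (simp add: Bij_def)
  show "(inv\<^bsub>BijGroup V\<^esub> A) v \<in> V" "A ((inv\<^bsub>BijGroup V\<^esub> A) v) = v" "(inv\<^bsub>BijGroup V\<^esub> A) (A v) = v"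
    using b assms(2) by (auto simp: inv bij_betw_def inv_into_into f_inv_into_f)
qed

text \<open>\<open>kb_H\<close> and \<open>kb_F\<close> commute since their two composites send
  column \<open>j\<close> to \<open>3 - j\<close> and \<open>7 - j\<close>, equal modulo 4.
  \<open>kb_U\<close> changes only the row, apart from the column reflection at the seam.\<close>

lemma gens_commute:
  assumes "A \<in> gens" "B \<in> gens" "v \<in> V"
  shows "A (B v) = B (A v)"
  using assms unfolding kb_vertices_4
  by (auto simp: kb_H_4) (auto simp: kb_U_def kb_F_def kb_H_def kb_vertices_def kb_col_def)

text \<open>Commutation passes to inverses and products. It lets agreement of two group elements at
  one vertex spread along the generators.\<close>

lemma KBLS_commute_gens:
  assumes "A \<in> KBLS m 4" "B \<in> gens" "v \<in> V"
  shows "A (B v) = B (A v)"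
proof -
  have BV: "B w \<in> V" if "w \<in> V" for w using that assms(2) gens_KBLS KBLS_mem by blast
  have "A \<in> generate (BijGroup V) gens" using assms(1) by (simp add: KBLS_def)
  thus ?thesis using assms(3)
  proof (induction A arbitrary: v rule: generate.induct)
    case one
    thus ?case using BV by (simp add: BijGroup_def)
  next
    case (incl A)
    thus ?case using gens_commute assms(2) by blast
  next
    case (inv A)
    let ?A' = "inv\<^bsub>BijGroup V\<^esub> A"
    have A: "A \<in> Bij V" using inv gens_Bij by blast
    note i = BijGroup_inv[OF A]
    have "B v = B (A (?A' v))" using i inv.prems by simp
    also have "\<dots> = A (B (?A' v))" using gens_commute[OF inv.hyps assms(2)] i inv.prems by simp
    finally show ?case using i BV inv.prems by simp
  next
    case (eng A1 A2)
    have "A1 \<in> KBLS m 4" "A2 \<in> KBLS m 4" using eng by (auto simp: KBLS_def)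
    thus ?case using eng KBLS_Bij KBLS_mem BV by (simp add: BijGroup_def compose_eq)
  qed
qed

text \<open>Both halves use \<open>kb_vertices_induct\<close>: the orbit of \<open>(1, 1)\<close> is
  closed under the generators, and so, by commutation, is the set of vertices where two group
  elements agree.\<close>

lemma KBLS_eval_bij: "bij_betw (\<lambda>A. A (1, 1)) (KBLS m 4) V"
proof (rule bij_betw_imageI)
  have 1: "(1, 1) \<in> V" using m by (simp add: kb_vertices_def)
  show "inj_on (\<lambda>A. A (1, 1)) (KBLS m 4)"
  proof (rule inj_onI)
    fix A B assume A: "A \<in> KBLS m 4" and B: "B \<in> KBLS m 4" and eq: "A (1, 1) = B (1, 1)"
    have "A (C v) = B (C v)" if "v \<in> V" "A v = B v" "C \<in> gens" for C v
      using KBLS_commute_gens[OF A that(3,1)] KBLS_commute_gens[OF B that(3,1)] that(2) by simp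
    hence "A v = B v" if "v \<in> V" for v
      by (intro kb_vertices_induct[OF m that, of "\<lambda>v. A v = B v"]) (use eq in simp_all)
    moreover have "A \<in> extensional V" "B \<in> extensional V" using KBLS_Bij A B by (auto simp: Bij_def)
    ultimately show "A = B" by (auto intro: extensionalityI)
  qed
  have "v \<in> (\<lambda>A. A (1, 1)) ` KBLS m 4" if "v \<in> V" for v
  proof (rule kb_vertices_induct[OF m that])
    show "(1, 1) \<in> (\<lambda>A. A (1, 1)) ` KBLS m 4" using KBLS_one 1 by (intro image_eqI) auto
    fix v assume "v \<in> (\<lambda>A. A (1, 1)) ` KBLS m 4"
    then obtain A where A: "A \<in> KBLS m 4" "v = A (1, 1)" by blast
    have "B v \<in> (\<lambda>A. A (1, 1)) ` KBLS m 4" if "B \<in> gens" for B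
      using KBLS_compose[of B A] gens_KBLS that A 1
      by (intro image_eqI[of _ _ "compose V B A"]) (auto simp: compose_eq)
    thus "kb_U m 4 v \<in> (\<lambda>A. A (1, 1)) ` KBLS m 4" "kb_H m 4 v \<in> (\<lambda>A. A (1, 1)) ` KBLS m 4"
      by auto
  qed
  thus "(\<lambda>A. A (1, 1)) ` KBLS m 4 = V" using KBLS_mem 1 by blast
qed

lemma card_KBLS: "card (KBLS m 4) = 4 * m"
  using bij_betw_same_card[OF KBLS_eval_bij] by (simp add: kb_vertices_def card_cartesian_product)

section \<open>Equivalence classes as orbits of labelings\<close>

lemma finite_kb_labelings: "finite (kb_labelings m 4)"
proof (rule finite_subset)
  show "kb_labelings m 4 \<subseteq> V \<rightarrow>\<^sub>E {1..m * 4}"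
    by (auto simp: kb_labelings_def PiE_def bij_betw_def)
  show "finite (V \<rightarrow>\<^sub>E {1..m * 4})" by (rule finite_PiE) (auto simp: kb_vertices_def)
qed

text \<open>Invariance under the generators is a hypothesis here;
  \<open>kb_act_gens_labelings\<close> supplies it from the shape of the labelings.\<close>

lemma kb_act_labelings:
  assumes gen: "\<And>A X. A \<in> gens \<Longrightarrow> X \<in> kb_labelings m 4 \<Longrightarrow> kb_act m 4 A X \<in> kb_labelings m 4"
    and A: "A \<in> KBLS m 4" and X: "X \<in> kb_labelings m 4"
  shows "kb_act m 4 A X \<in> kb_labelings m 4"
proof -
  have undef: "X v = undefined" if "X \<in> kb_labelings m 4" "v \<notin> V" for X v
    using that unfolding kb_labelings_def extensional_def by blast
  have "A \<in> generate (BijGroup V) gens" using A by (simp add: KBLS_def)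
  thus ?thesis using X
  proof (induction A arbitrary: X rule: generate.induct)
    case one
    hence "kb_act m 4 \<one>\<^bsub>BijGroup V\<^esub> X = X"
      using undef[OF one] by (intro ext) (simp add: kb_act_def BijGroup_def restrict_def)
    thus ?case using one by simp
  next
    case (incl A)
    thus ?case using gen by blast
  next
    case (inv A)
    let ?A' = "inv\<^bsub>BijGroup V\<^esub> A"
    have AB: "A \<in> Bij V" using inv gens_Bij by blast
    hence AV: "A v \<in> V" if "v \<in> V" for v using that by (auto simp: Bij_def bij_betw_def)
    note i = BijGroup_inv[OF AB]
    have undo: "kb_act m 4 ?A' (kb_act m 4 A Y) = Y" if "Y \<in> kb_labelings m 4" for Y
      using i AV undef[OF that] by (intro ext) (simp add: kb_act_def restrict_def)
    \<comment> \<open>No faces need inspection for an inverse generator: an injective map of a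
      finite set into itself is onto, so \<open>X\<close> comes from a labeling \<open>Y\<close>
      under \<open>A\<close>.\<close>
    have "inj_on (kb_act m 4 A) (kb_labelings m 4)" by (rule inj_on_inverseI) (rule undo)
    hence "kb_act m 4 A ` kb_labelings m 4 = kb_labelings m 4"
      using gen[OF inv.hyps] finite_kb_labelings by (intro endo_inj_surj) auto
    then obtain Y where "Y \<in> kb_labelings m 4" "X = kb_act m 4 A Y" using inv.prems by blast
    thus ?case using undo by simp
  next
    case (eng A1 A2)
    have K: "A1 \<in> KBLS m 4" "A2 \<in> KBLS m 4" using eng by (auto simp: KBLS_def)
    \<comment> \<open>The action is contravariant: the left factor acts first.\<close>
    hence "kb_act m 4 (A1 \<otimes>\<^bsub>BijGroup V\<^esub> A2) X = kb_act m 4 A2 (kb_act m 4 A1 X)"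
      using KBLS_mem KBLS_Bij by (auto simp: kb_act_def BijGroup_def compose_eq fun_eq_iff)
    thus ?case using eng by simp
  qed
qed

text \<open>A class is an orbit, and since labels are distinct, different group elements give
  different labelings. Every class therefore has as many elements as the group.\<close>

lemma card_kb_quotient:
  assumes gen: "\<And>A X. A \<in> gens \<Longrightarrow> X \<in> kb_labelings m 4 \<Longrightarrow> kb_act m 4 A X \<in> kb_labelings m 4"
  shows "card (kb_labelings m 4) = 4 * m * card (kb_labelings m 4 // kb_equivalence m 4)"
proof -
  let ?L = "kb_labelings m 4" and ?R = "kb_equivalence m 4"
  have eq: "equiv ?L ?R" by (rule equiv_kb_equivalence) simp
  have "card C = 4 * m" if C: "C \<in> ?L // ?R" for C
  proof -
    obtain X where X: "X \<in> ?L" "C = ?R `` {X}" using C by (auto elim: quotientE)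
    have C': "C = (\<lambda>A. kb_act m 4 A X) ` KBLS m 4"
      using X kb_act_labelings[OF gen] by (auto simp: kb_equivalence_def)
    have "inj_on (\<lambda>A. kb_act m 4 A X) (KBLS m 4)"
    proof (rule inj_onI)
      fix A B assume A: "A \<in> KBLS m 4" and B: "B \<in> KBLS m 4"
        and e: "kb_act m 4 A X = kb_act m 4 B X"
      have "inj_on X V" using X by (auto simp: kb_labelings_def bij_betw_def)
      moreover have "X (A v) = X (B v)" if "v \<in> V" for v
        using fun_cong[OF e, of v] that by (simp add: kb_act_def)
      ultimately have "A v = B v" if "v \<in> V" for v
        using KBLS_mem[OF A that] KBLS_mem[OF B that] that by (meson inj_onD)
      moreover have "A \<in> extensional V" "B \<in> extensional V" using KBLS_Bij A B by (auto simp: Bij_def)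
      ultimately show "A = B" by (auto intro: extensionalityI)
    qed
    thus ?thesis using C' card_KBLS by (simp add: card_image)
  qed
  moreover have "finite (?L // ?R)"
    using finite_kb_labelings eq by (simp add: finite_quotient equiv_def)
  moreover have "\<Union> (?L // ?R) = ?L" by (rule Union_quotient[OF eq])
  ultimately show ?thesis
    using card_partition[of "?L // ?R" "4 * m"] finite_kb_labelings quotient_disj[OF eq]
    by metis
qed

end

section \<open>The shape of a labeling\<close>

text \<open>Columns 3 and 4 are columns 1 and 2 lowered by \<open>D\<close>. Sums of cyclically
  adjacent entries are \<open>M + D\<close>, \<open>M\<close>, \<open>M - D\<close>,
  \<open>M\<close>.\<close>

definition row_pattern :: "int \<Rightarrow> int \<Rightarrow> (nat \<Rightarrow> int) \<Rightarrow> nat \<times> nat \<Rightarrow> int" where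
  "row_pattern M D a = (\<lambda>(i, j).
     if j = 1 then a i else if j = 2 then M + D - a i else if j = 3 then a i - D else M - a i)"

lemma row_pattern_simps [simp]:
  "row_pattern M D a (i, 1) = a i" "row_pattern M D a (i, Suc 0) = a i"
  "row_pattern M D a (i, 2) = M + D - a i"
  "row_pattern M D a (i, 3) = a i - D" "row_pattern M D a (i, 4) = M - a i"
  by (simp_all add: row_pattern_def)

text \<open>Reversing a row exchanges the pair sums \<open>M + D\<close> and \<open>M - D\<close>,
  so that a row and a reversed row together give face sums \<open>2 * M\<close>.\<close>

definition flip_even_rows :: "nat \<times> nat \<Rightarrow> nat \<times> nat" where
  "flip_even_rows = (\<lambda>(i, j). (i, if odd i then j else 5 - j))"

lemma flip_even_rows_simps [simp]:
  "odd i \<Longrightarrow> flip_even_rows (i, j) = (i, j)" "even i \<Longrightarrow> flip_even_rows (i, j) = (i, 5 - j)"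
  by (simp_all add: flip_even_rows_def)

lemma flip_even_rows_bij: "bij_betw flip_even_rows (kb_vertices m 4) (kb_vertices m 4)"
  by (rule bij_betw_byWitness[where f' = flip_even_rows])
     (auto simp: flip_even_rows_def kb_vertices_def)

text \<open>The labels in columns 3 and 4 are those in columns 1 and 2 translated by
  \<open>-D\<close>, so surjectivity and disjointness of the halves are a tiling problem.
  Injectivity on columns 1 and 2 is the transversal condition for different rows and
  \<open>stripes_reflect_neq\<close> within a row.\<close>

lemma row_pattern_bij_iff:
  fixes m :: nat and D :: int and a :: "nat \<Rightarrow> int"
  assumes m: "odd m" and a: "a \<in> extensional {1..m}"
  shows "bij_betw (row_pattern (4 * int m + 1) D a) (kb_vertices m 4) {1..4 * int m} \<longleftrightarrow>
     D dvd 2 * int m \<and>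
     a \<in> transversals {1..m} (stripes (4 * int m) D) (\<lambda>x. 4 * int m + 1 + D - x)"
    (is "bij_betw ?g ?V {1..?N} \<longleftrightarrow> _ \<and> a \<in> transversals ?I ?S ?f")
proof -
  have m0: "m > 0" using m by (cases m) auto
  hence N: "?N > 0" by simp
  let ?L = "?I \<times> {1, 2 :: nat}" and ?R = "?I \<times> {3, 4 :: nat}"
  have cols: "{1..4 :: nat} = {1, 2} \<union> {3, 4}" by auto
  have V: "?V = ?L \<union> ?R" unfolding kb_vertices_def cols by blast
  have shift: "?g ` ?R = (\<lambda>x. x - D) ` ?g ` ?L"
  proof -
    have "?R = (\<lambda>(i, j). (i, j + 2)) ` ?L" by (auto simp: image_iff)
    hence "?g ` ?R = (\<lambda>v. ?g ((\<lambda>(i, j). (i, j + 2)) v)) ` ?L" by (simp add: image_image)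
    also have "\<dots> = (\<lambda>v. ?g v - D) ` ?L" by (rule image_cong) (auto simp: row_pattern_def)
    finally show ?thesis by (simp add: image_image)
  qed
  have dvd: "2 * D dvd ?N \<longleftrightarrow> D dvd 2 * int m"
    using dvd_mult_cancel_left[of 2 D "2 * int m"] by simp
  show ?thesis
  proof
    assume bij: "bij_betw ?g ?V {1..?N}"
    hence inj: "inj_on ?g ?V" by (simp add: bij_betw_def)
    have "?g ` ?L \<union> ?g ` ?R = {1..?N}" using bij unfolding V bij_betw_def by (simp add: image_Un)
    moreover have "?g ` ?L \<inter> ?g ` ?R = {}"
    proof -
      have "?g ` ?L \<inter> ?g ` ?R = ?g ` (?L \<inter> ?R)"
        using inj unfolding V by (intro inj_on_image_Int[symmetric]) auto
      thus ?thesis by auto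
    qed
    ultimately have *: "2 * D dvd ?N \<and> ?g ` ?L = ?S"
      using shift_tiling_iff[OF N, of "?g ` ?L" D] shift by simp
    have "a i \<in> ?S" if "i \<in> ?I" for i
    proof -
      have "?g (i, 1) \<in> ?g ` ?L" using that by blast
      thus ?thesis using * by simp
    qed
    moreover have "a i \<noteq> a j" "a i \<noteq> ?f (a j)" if "i \<in> ?I" "j \<in> ?I" "i \<noteq> j" for i j
      using that inj_onD[OF inj, of "(i, 1)" "(j, 1)"] inj_onD[OF inj, of "(i, 1)" "(j, 2)"]
      by (auto simp: kb_vertices_def)
    ultimately show "D dvd 2 * int m \<and> a \<in> transversals ?I ?S ?f"
      using * dvd a by (auto simp: transversals_def PiE_def)
  next
    assume asm: "D dvd 2 * int m \<and> a \<in> transversals ?I ?S ?f"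
    hence D2: "2 * D dvd ?N" using dvd by simp
    have aS: "a i \<in> ?S" if "i \<in> ?I" for i using asm that by (auto simp: transversals_def)
    have d: "a i \<noteq> a j" "a i \<noteq> ?f (a j)" if "i \<in> ?I" "j \<in> ?I" "i \<noteq> j" for i j
      using asm that unfolding transversals_def by blast+
    have fS: "?f x \<in> ?S" if "x \<in> ?S" for x using stripes_reflect[OF N D2 that] by simp
    have ne: "?f x \<noteq> x" if "x \<in> ?S" for x
      using stripes_reflect_neq[of "int m" D x] m m0 asm that by simp
    have "inj_on ?g ?L"
    proof (rule inj_onI)
      fix u v assume u: "u \<in> ?L" and v: "v \<in> ?L" and eq: "?g u = ?g v"
      obtain i j k l where uv: "u = (i, j)" "v = (k, l)" by (cases u, cases v)
      have "i = k"
      proof (rule ccontr)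
        assume "i \<noteq> k"
        thus False using d[of i k] d(2)[of k i] u v eq unfolding uv by fastforce
      qed
      thus "u = v" using u v eq ne[OF aS, of i] unfolding uv by auto
    qed
    moreover have "?g ` ?L \<subseteq> ?S" using aS fS by auto
    \<comment> \<open>Both sets have \<open>2 * m\<close> elements, so the injection into the
      stripes is onto.\<close>
    moreover have "card ?L = card ?S"
      using card_stripes[OF N D2] by (simp add: card_cartesian_product)
    ultimately have L: "?g ` ?L = ?S"
      by (intro card_subset_eq finite_stripes) (auto simp: card_image)
    have im: "?g ` ?V = {1..?N}"
      unfolding V image_Un shift L using stripes_tiling(1)[OF N D2] .
    \<comment> \<open>Injectivity on all vertices follows from surjectivity between finite sets of
      equal size.\<close>
    moreover have "card ?V = card {1..?N}" by (simp add: kb_vertices_def card_cartesian_product)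
    moreover have "finite ?V" by (simp add: kb_vertices_def)
    ultimately show "bij_betw ?g ?V {1..?N}"
      unfolding bij_betw_def by (metis eq_card_imp_inj_on)
  qed
qed

section \<open>Face equations and their solutions\<close>

lemma kb_faces_4:
  "kb_faces m 4 =
     (\<Union>i\<in>{1..m - 1}. {{(i, 1), (i, 2), (i + 1, 1), (i + 1, 2)}, {(i, 2), (i, 3), (i + 1, 2), (i + 1, 3)},
        {(i, 3), (i, 4), (i + 1, 3), (i + 1, 4)}, {(i, 4), (i, 1), (i + 1, 4), (i + 1, 1)}}) \<union>
     {{(m, 1), (m, 2), (1, 4), (1, 3)}, {(m, 2), (m, 3), (1, 3), (1, 2)},
      {(m, 3), (m, 4), (1, 2), (1, 1)}, {(m, 4), (m, 1), (1, 1), (1, 4)}}"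
proof -
  have j: "1 \<le> j \<and> j \<le> 4 \<longleftrightarrow> j = 1 \<or> j = 2 \<or> j = 3 \<or> j = 4" for j :: nat by auto
  have A: "{F i j |i j. 1 \<le> i \<and> i \<le> m - 1 \<and> 1 \<le> j \<and> j \<le> 4} = (\<Union>i\<in>{1..m - 1}. {F i 1, F i 2, F i 3, F i 4})"
    for F :: "nat \<Rightarrow> nat \<Rightarrow> (nat \<times> nat) set"
    unfolding j by auto blast+
  have B: "{F j |j. 1 \<le> j \<and> j \<le> 4} = {F 1, F 2, F 3, F 4}" for F :: "nat \<Rightarrow> (nat \<times> nat) set"
    unfolding j by auto
  have c: "kb_col 4 (1 + 1) = 2" "kb_col 4 (2 + 1) = 3" "kb_col 4 (3 + 1) = 4" "kb_col 4 (4 + 1) = 1"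
    "kb_col 4 (4 - 1) = 3" "kb_col 4 (4 - 2) = 2" "kb_col 4 (4 - 3) = 1" "kb_col 4 (4 - 4) = 4"
    by (simp_all add: kb_col_def)
  have d: "4 + 1 - 1 = (4 :: nat)" "4 + 1 - 2 = (3 :: nat)" "4 + 1 - 3 = (2 :: nat)" "4 + 1 - 4 = (1 :: nat)"
    by simp_all
  show ?thesis unfolding kb_faces_def A B c d ..
qed

text \<open>With \<open>m \<ge> 2\<close> the rows \<open>m\<close> and 1 differ, so each face has
  four distinct vertices and its sum splits into four terms.\<close>

lemma kb_face_sums_4:
  fixes X :: "nat \<times> nat \<Rightarrow> 'a :: comm_monoid_add"
  assumes m: "m \<ge> 2"
  shows "(\<forall>f\<in>kb_faces m 4. sum X f = S) \<longleftrightarrow>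
    (\<forall>i\<in>{1..m - 1}. X (i, 1) + X (i, 2) + X (i + 1, 1) + X (i + 1, 2) = S
       \<and> X (i, 2) + X (i, 3) + X (i + 1, 2) + X (i + 1, 3) = S
       \<and> X (i, 3) + X (i, 4) + X (i + 1, 3) + X (i + 1, 4) = S
       \<and> X (i, 4) + X (i, 1) + X (i + 1, 4) + X (i + 1, 1) = S)
    \<and> X (m, 1) + X (m, 2) + X (1, 4) + X (1, 3) = S
    \<and> X (m, 2) + X (m, 3) + X (1, 3) + X (1, 2) = S
    \<and> X (m, 3) + X (m, 4) + X (1, 2) + X (1, 1) = S
    \<and> X (m, 4) + X (m, 1) + X (1, 1) + X (1, 4) = S"
proof -
  have "m \<noteq> 1" using m by simp
  moreover have "i \<noteq> i + 1" for i :: nat by simp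
  ultimately show ?thesis unfolding kb_faces_4 by (simp add: ball_Un add.assoc) blast
qed

text \<open>From one row to the next, each sum \<open>p\<close> of two cyclically adjacent entries
  becomes \<open>S - p\<close>. As \<open>m\<close> is odd, the last row has the pair sums of the
  first, and the reversing seam relates these to each other. The total of all labels then fixes
  \<open>S\<close>.\<close>

lemma kb_labelings_4_iff:
  fixes m :: nat
  assumes m: "m \<ge> 2" "odd m"
  shows "X \<in> kb_labelings m 4 \<longleftrightarrow>
    X \<in> extensional (kb_vertices m 4) \<and> bij_betw X (kb_vertices m 4) {1..m * 4} \<and>
    (\<exists>D a. \<forall>v\<in>kb_vertices m 4. int (X v) = row_pattern (4 * int m + 1) D a (flip_even_rows v))"
    (is "_ \<longleftrightarrow> ?E \<and> ?B \<and> ?P")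
proof -
  have vert: "(i, 1) \<in> kb_vertices m 4" "(i, 2) \<in> kb_vertices m 4"
    "(i, 3) \<in> kb_vertices m 4" "(i, 4) \<in> kb_vertices m 4" if "i \<in> {1..m}" for i
    using that by (simp_all add: kb_vertices_def)
  define M where "M = 4 * int m + 1"
  define x where "x i j = int (X (i, j))" for i j
  \<comment> \<open>The equations are solved over the integers, since \<open>D\<close> may be
    negative.\<close>
  have sums: "(\<forall>f\<in>kb_faces m 4. sum X f = S) \<longleftrightarrow> (\<forall>f\<in>kb_faces m 4. (\<Sum>(i, j)\<in>f. x i j) = int S)" for S
    by (simp add: x_def case_prod_unfold flip: of_nat_sum)
  note int_sums = sums[unfolded kb_face_sums_4[OF m(1), of "\<lambda>(i, j). x i j"] prod.case]
  have "(\<exists>S. \<forall>f\<in>kb_faces m 4. sum X f = S)" if pattern: ?P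
  proof -
    obtain D a where P: "\<forall>v\<in>kb_vertices m 4. int (X v) = row_pattern M D a (flip_even_rows v)"
      using pattern unfolding M_def by blast
    have odd: "x i 1 = a i \<and> x i 2 = M + D - a i \<and> x i 3 = a i - D \<and> x i 4 = M - a i"
      if "i \<in> {1..m}" "odd i" for i
      using P vert[OF that(1)] that(2) by (simp add: x_def)
    have even: "x i 4 = a i \<and> x i 3 = M + D - a i \<and> x i 2 = a i - D \<and> x i 1 = M - a i"
      if "i \<in> {1..m}" "even i" for i
      using P vert[OF that(1)] that(2) by (simp add: x_def)
    \<comment> \<open>Consecutive rows have opposite orientation, and the seam joins the odd rows
      \<open>m\<close> and 1 with a reversal. Either way \<open>M + D\<close> meets
      \<open>M - D\<close>, and \<open>M\<close> meets \<open>M\<close>.\<close>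
    have "\<forall>f\<in>kb_faces m 4. sum X f = 2 * (4 * m + 1)"
      unfolding int_sums
    proof (intro conjI ballI)
      fix i assume i: "i \<in> {1..m - 1}"
      hence i': "i \<in> {1..m}" "i + 1 \<in> {1..m}" using m by auto
      show "x i 1 + x i 2 + x (i + 1) 1 + x (i + 1) 2 = int (2 * (4 * m + 1))"
        "x i 2 + x i 3 + x (i + 1) 2 + x (i + 1) 3 = int (2 * (4 * m + 1))"
        "x i 3 + x i 4 + x (i + 1) 3 + x (i + 1) 4 = int (2 * (4 * m + 1))"
        "x i 4 + x i 1 + x (i + 1) 4 + x (i + 1) 1 = int (2 * (4 * m + 1))"
        using odd[OF i'(1)] odd[OF i'(2)] even[OF i'(1)] even[OF i'(2)]
        by (cases "odd i"; simp add: M_def)+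
    next
      have mm: "m \<in> {1..m}" "1 \<in> {1..m}" using m by auto
      show "x m 1 + x m 2 + x 1 4 + x 1 3 = int (2 * (4 * m + 1))"
        "x m 2 + x m 3 + x 1 3 + x 1 2 = int (2 * (4 * m + 1))"
        "x m 3 + x m 4 + x 1 2 + x 1 1 = int (2 * (4 * m + 1))"
        "x m 4 + x m 1 + x 1 1 + x 1 4 = int (2 * (4 * m + 1))"
        using odd[OF mm(1) m(2)] odd[OF mm(2) odd_one] by (simp_all add: M_def)
    qed
    thus ?thesis by blast
  qed
  moreover have ?P if bij: ?B and S: "\<forall>f\<in>kb_faces m 4. sum X f = S" for S
  proof -
    define s where "s = int S"
    define p1 where "p1 = x 1 1 + x 1 2"
    define p2 where "p2 = x 1 2 + x 1 3"
    define p3 where "p3 = x 1 3 + x 1 4"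
    define p4 where "p4 = x 1 4 + x 1 1"
    note eqs = S[unfolded int_sums, folded s_def]
    have next_row: "x i 1 + x i 2 + x (Suc i) 1 + x (Suc i) 2 = s \<and>
        x i 2 + x i 3 + x (Suc i) 2 + x (Suc i) 3 = s \<and>
        x i 3 + x i 4 + x (Suc i) 3 + x (Suc i) 4 = s \<and>
        x i 4 + x i 1 + x (Suc i) 4 + x (Suc i) 1 = s" if "1 \<le> i" "i < m" for i
      using conjunct1[OF eqs, THEN bspec, of i] that by auto
    have wrap: "x m 1 + x m 2 + x 1 4 + x 1 3 = s \<and> x m 2 + x m 3 + x 1 3 + x 1 2 = s \<and>
        x m 3 + x m 4 + x 1 2 + x 1 1 = s \<and> x m 4 + x m 1 + x 1 1 + x 1 4 = s"
      using conjunct2[OF eqs] .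
    have alt: "if odd i
        then x i 1 + x i 2 = p1 \<and> x i 2 + x i 3 = p2 \<and> x i 3 + x i 4 = p3 \<and> x i 4 + x i 1 = p4
        else x i 1 + x i 2 = s - p1 \<and> x i 2 + x i 3 = s - p2 \<and>
             x i 3 + x i 4 = s - p3 \<and> x i 4 + x i 1 = s - p4"
      if "1 \<le> i" "i \<le> m" for i
      using that
    proof (induction i rule: dec_induct)
      case base
      show ?case by (simp add: p1_def p2_def p3_def p4_def)
    next
      case (step i)
      have "i < m" "i \<le> m" using step.prems by auto
      thus ?case using step.IH next_row[OF step.hyps(1)]
        by (cases "odd i") simp_all
    qed
    \<comment> \<open>Across the seam, pairs 1 and 3 face each other, while pairs 2 and 4 face
      themselves.\<close>
    have p: "p1 + p3 = s" "2 * p2 = s" "2 * p4 = s"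
      using alt[of m] m wrap unfolding p1_def p2_def p3_def p4_def by auto
    \<comment> \<open>Pairs 1 and 3 cover a row, so every row sums to \<open>s\<close>; comparison
      with the sum of all labels yields \<open>s = 2 * M\<close>.\<close>
    have row: "x i 1 + x i 2 + x i 3 + x i 4 = s" if "i \<in> {1..m}" for i
      using alt[of i] that p by (cases "odd i") auto
    have "(\<Sum>v\<in>kb_vertices m 4. int (X v)) = (\<Sum>i\<in>{1..m}. \<Sum>j\<in>{1..4}. x i j)"
      unfolding kb_vertices_def x_def by (simp add: sum.cartesian_product)
    also have "\<dots> = (\<Sum>i\<in>{1..m}. s)"
    proof (rule sum.cong[OF refl])
      fix i assume "i \<in> {1..m}"
      moreover have "{1..4} = {1, 2, 3, 4 :: nat}" by auto
      ultimately show "(\<Sum>j\<in>{1..4}. x i j) = s" using row[of i] by simp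
    qed
    finally have "(\<Sum>v\<in>kb_vertices m 4. int (X v)) = int m * s" by simp
    moreover have "(\<Sum>v\<in>kb_vertices m 4. int (X v)) = (\<Sum>k\<in>{1..m * 4}. int k)"
      using sum.reindex_bij_betw[OF bij, of int] .
    moreover have "2 * (\<Sum>k\<in>{1..n}. int k) = int n * (int n + 1)" for n
      by (induction n) (auto simp: algebra_simps)
    ultimately have "2 * (int m * s) = int (m * 4) * (int (m * 4) + 1)" by metis
    hence "int m * s = int m * (2 * M)" by (simp add: M_def algebra_simps)
    hence s: "s = 2 * M" using m by simp
    \<comment> \<open>\<open>D\<close> is the deviation of the first pair sum from \<open>M\<close>,
      the mean of \<open>p1\<close> and \<open>p3\<close>; \<open>a\<close> reads the column that
      \<open>flip_even_rows\<close> moves to the front.\<close>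
    define D where "D = p1 - M"
    define a where "a i = (if odd i then x i 1 else x i 4)" for i
    have "int (X v) = row_pattern M D a (flip_even_rows v)" if v: "v \<in> kb_vertices m 4" for v
    proof -
      obtain i where i: "i \<in> {1..m}" "v = (i, 1) \<or> v = (i, 2) \<or> v = (i, 3) \<or> v = (i, 4)"
        using v unfolding kb_vertices_4 by blast
      show ?thesis
      proof (cases "odd i")
        case True
        have "x i 1 = a i \<and> x i 2 = M + D - a i \<and> x i 3 = a i - D \<and> x i 4 = M - a i"
          using alt[of i] i(1) p s True by (auto simp: a_def D_def)
        thus ?thesis using i(2) True unfolding x_def by auto
      next
        case False
        have "x i 4 = a i \<and> x i 3 = M + D - a i \<and> x i 2 = a i - D \<and> x i 1 = M - a i"
          using alt[of i] i(1) p s False by (auto simp: a_def D_def)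
        thus ?thesis using i(2) False unfolding x_def by auto
      qed
    qed
    thus ?thesis unfolding M_def by blast
  qed
  ultimately show ?thesis unfolding kb_labelings_def by blast
qed

text \<open>Each generator preserves the normal form and replaces \<open>D\<close> by
  \<open>- D\<close>: \<open>kb_H\<close> exchanges the halves of a row, \<open>kb_F\<close>
  reverses it, and \<open>kb_U\<close> reads a neighbouring row of opposite orientation.\<close>

lemma kb_act_gens_labelings:
  assumes m: "m \<ge> 2" "odd m" and A: "A \<in> {kb_U m 4, kb_H m 4, kb_F m 4}"
    and X: "X \<in> kb_labelings m 4"
  shows "kb_act m 4 A X \<in> kb_labelings m 4"
proof -
  let ?V = "kb_vertices m 4" and ?M = "4 * int m + 1"
  obtain D a where P: "\<forall>v\<in>?V. int (X v) = row_pattern ?M D a (flip_even_rows v)"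
    using X unfolding kb_labelings_4_iff[OF m] by blast
  have AB: "bij_betw A ?V ?V" using A kb_U_in_Bij kb_H_in_Bij kb_F_in_Bij by (auto simp: Bij_def)
  have "bij_betw (X \<circ> A) ?V {1..m * 4}"
    using X AB unfolding kb_labelings_4_iff[OF m] by (auto intro: bij_betw_trans)
  hence "bij_betw (kb_act m 4 A X) ?V {1..m * 4}"
    by (rule bij_betw_cong[THEN iffD1, rotated]) (simp add: kb_act_def)
  moreover have "\<exists>D' a'. \<forall>v\<in>?V. int (kb_act m 4 A X v) = row_pattern ?M D' a' (flip_even_rows v)"
  proof -
    \<comment> \<open>\<open>a' i\<close> is the label moved into the leading cell of row
      \<open>i\<close>: the fourth entry of a row for \<open>kb_U\<close> and \<open>kb_F\<close>,
      the third for \<open>kb_H\<close>.\<close>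
    define a' where "a' i = (if A = kb_U m 4 then ?M - a (if i < m then i + 1 else 1)
      else if A = kb_H m 4 then a i - D else ?M - a i)" for i
    have "int (X (A v)) = row_pattern ?M (- D) a' (flip_even_rows v)" if v: "v \<in> ?V" for v
    proof -
      have "A v \<in> ?V" using AB v by (auto simp: bij_betw_def)
      hence "int (X (A v)) = row_pattern ?M D a (flip_even_rows (A v))" using P by blast
      also obtain i where i: "i \<in> {1..m}" "v = (i, 1) \<or> v = (i, 2) \<or> v = (i, 3) \<or> v = (i, 4)"
        using v unfolding kb_vertices_4 by blast
      have "row_pattern ?M D a (flip_even_rows (A v)) = row_pattern ?M (- D) a' (flip_even_rows v)"
      proof (cases "A = kb_U m 4")
        case True
        have "A v = (if i < m then (i + 1, snd v) else (1, 5 - snd v))"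
          using i True by (auto simp: kb_U_def kb_vertices_def)
        moreover have "i = m" if "\<not> i < m" using that i by auto
        ultimately show ?thesis using i(2) True m
          by (cases "i < m"; cases "odd i") (auto simp: a'_def)
      next
        case F: False
        show ?thesis
        proof (cases "A = kb_H m 4")
          case True
          thus ?thesis using i F kb_H_4[OF i(1)] by (cases "odd i") (auto simp: a'_def)
        next
          case False
          hence "A v = (i, 5 - snd v)" using A F i by (auto simp: kb_F_def kb_vertices_def)
          thus ?thesis using i(2) F False by (cases "odd i") (auto simp: a'_def)
        qed
      qed
      finally show ?thesis .
    qed
    hence "\<forall>v\<in>?V. int (kb_act m 4 A X v) = row_pattern ?M (- D) a' (flip_even_rows v)"
      by (simp add: kb_act_def)
    thus ?thesis by blast
  qed
  ultimately show ?thesis unfolding kb_labelings_4_iff[OF m] by (simp add: kb_act_def)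
qed

text \<open>Labelings correspond bijectively to pairs of a divisor \<open>D\<close> and a
  transversal for \<open>D\<close>, and the number of transversals is the same for all
  \<open>D\<close>.\<close>

lemma card_kb_labelings_4:
  assumes m: "m \<ge> 2" "odd m"
  shows "card (kb_labelings m 4) = 4 * card {d. d dvd m} * (2 ^ m * fact m)"
proof -
  let ?V = "kb_vertices m 4" and ?M = "4 * int m + 1" and ?N = "4 * int m"
  let ?Q = "\<lambda>D. transversals {1..m} (stripes ?N D) (\<lambda>x. ?M + D - x)"
  let ?D = "{D. D dvd 2 * int m}"
  let ?h = "\<lambda>(D, a). \<lambda>v\<in>?V. nat (row_pattern ?M D a (flip_even_rows v))"
  have flipV: "flip_even_rows v \<in> ?V" if "v \<in> ?V" for v
    using that flip_even_rows_bij[of m] by (auto simp: bij_betw_def)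
  have flip2: "flip_even_rows (flip_even_rows v) = v" if "v \<in> ?V" for v
    using that by (auto simp: flip_even_rows_def kb_vertices_def)
  have ext: "a \<in> extensional {1..m}" if "a \<in> ?Q D" for D a using that by (simp add: transversals_def PiE_def)
  \<comment> \<open>Positivity makes the conversion \<open>nat\<close> in \<open>?h\<close>
    lossless.\<close>
  have pos: "row_pattern ?M D a v > 0" if "D \<in> ?D" "a \<in> ?Q D" "v \<in> ?V" for D a v
  proof -
    have "bij_betw (row_pattern ?M D a) ?V {1..?N}"
      using row_pattern_bij_iff[OF m(2) ext[OF that(2)]] that by simp
    hence "row_pattern ?M D a v \<in> {1..?N}" using that(3) by (auto simp: bij_betw_def)
    thus ?thesis by simp
  qed
  have "inj_on ?h (Sigma ?D ?Q)"
  proof (rule inj_onI)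
    fix y z assume y: "y \<in> Sigma ?D ?Q" and z: "z \<in> Sigma ?D ?Q" and eq: "?h y = ?h z"
    obtain D a D' a' where yz: "y = (D, a)" "z = (D', a')" by (cases y, cases z)
    have Da: "D \<in> ?D" "a \<in> ?Q D" "D' \<in> ?D" "a' \<in> ?Q D'" using y z yz by auto
    have e: "row_pattern ?M D a v = row_pattern ?M D' a' v" if v: "v \<in> ?V" for v
    proof -
      have "nat (row_pattern ?M D a v) = nat (row_pattern ?M D' a' v)"
        using fun_cong[OF eq, of "flip_even_rows v"] flipV[OF v] flip2[OF v] unfolding yz by simp
      thus ?thesis using pos[OF Da(1,2) v] pos[OF Da(3,4) v] by simp
    qed
    have "a i = a' i" if "i \<in> {1..m}" for i using e[of "(i, 1)"] that by (simp add: kb_vertices_def)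
    hence "a = a'" by (rule extensionalityI[OF ext[OF Da(2)] ext[OF Da(4)]])
    moreover have "D = D'" using e[of "(1, 3)"] m \<open>a = a'\<close> by (simp add: kb_vertices_def)
    ultimately show "y = z" using yz by simp
  qed
  moreover have "?h ` Sigma ?D ?Q = kb_labelings m 4"
  proof (intro equalityI subsetI)
    fix X assume "X \<in> ?h ` Sigma ?D ?Q"
    then obtain D a where Da: "D \<in> ?D" "a \<in> ?Q D" and X: "X = ?h (D, a)" by auto
    have "bij_betw (row_pattern ?M D a) ?V {1..?N}"
      using row_pattern_bij_iff[OF m(2) ext[OF Da(2)]] Da by simp
    hence "bij_betw (row_pattern ?M D a \<circ> flip_even_rows) ?V {1..?N}"
      by (rule bij_betw_trans[OF flip_even_rows_bij])
    moreover have "bij_betw nat {1..?N} {1..m * 4}"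
      by (rule bij_betw_byWitness[where f' = int]) auto
    ultimately have "bij_betw (nat \<circ> (row_pattern ?M D a \<circ> flip_even_rows)) ?V {1..m * 4}"
      by (rule bij_betw_trans)
    hence "bij_betw X ?V {1..m * 4}"
      by (rule bij_betw_cong[THEN iffD1, rotated]) (simp add: X)
    moreover have "\<forall>v\<in>?V. int (X v) = row_pattern ?M D a (flip_even_rows v)"
      using pos[OF Da] flipV by (simp add: X less_imp_le)
    ultimately show "X \<in> kb_labelings m 4"
      unfolding kb_labelings_4_iff[OF m] by (auto simp: X)
  next
    fix X assume "X \<in> kb_labelings m 4"
    then obtain D b where X: "X \<in> extensional ?V" "bij_betw X ?V {1..m * 4}"
      and P: "\<forall>v\<in>?V. int (X v) = row_pattern ?M D b (flip_even_rows v)"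
      unfolding kb_labelings_4_iff[OF m] by blast
    \<comment> \<open>Values of \<open>b\<close> outside the row indices are arbitrary; restriction
      makes the sequence unique.\<close>
    define a where "a = restrict b {1..m}"
    have "row_pattern ?M D b v = row_pattern ?M D a v" if "v \<in> ?V" for v
      using that by (auto simp: a_def row_pattern_def kb_vertices_def)
    hence P': "int (X v) = row_pattern ?M D a (flip_even_rows v)" if "v \<in> ?V" for v
      using P that flipV by simp
    have "bij_betw int {1..m * 4} {1..?N}"
      by (rule bij_betw_byWitness[where f' = nat]) auto
    hence "bij_betw (int \<circ> X) ?V {1..?N}" by (rule bij_betw_trans[OF X(2)])
    hence "bij_betw (int \<circ> X \<circ> flip_even_rows) ?V {1..?N}"
      by (rule bij_betw_trans[OF flip_even_rows_bij])
    hence "bij_betw (row_pattern ?M D a) ?V {1..?N}"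
      by (rule bij_betw_cong[THEN iffD1, rotated]) (simp add: P' flipV flip2)
    hence "D \<in> ?D" "a \<in> ?Q D" using row_pattern_bij_iff[OF m(2), of a D] by (simp_all add: a_def)
    moreover have "X = ?h (D, a)"
    proof (rule extensionalityI[OF X(1)])
      show "?h (D, a) \<in> extensional ?V" by simp
      show "X v = ?h (D, a) v" if "v \<in> ?V" for v using P'[OF that, symmetric] that by simp
    qed
    ultimately show "X \<in> ?h ` Sigma ?D ?Q" by (intro image_eqI[of _ _ "(D, a)"]) auto
  qed
  ultimately have "card (kb_labelings m 4) = card (Sigma ?D ?Q)"
    using card_image[of ?h "Sigma ?D ?Q"] by argo
  also have "\<dots> = (\<Sum>D\<in>?D. card (?Q D))"
  proof (rule card_SigmaI)
    show "finite ?D" using card_int_divisors_double_odd(1)[OF m(2)] .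
    show "\<forall>D\<in>?D. finite (?Q D)"
    proof
      fix D
      have "?Q D \<subseteq> {1..m} \<rightarrow>\<^sub>E stripes ?N D" by (auto simp: transversals_def)
      thus "finite (?Q D)" by (rule finite_subset) (simp add: finite_PiE finite_stripes)
    qed
  qed
  also have "\<dots> = (\<Sum>D\<in>?D. 2 ^ m * fact m)"
  proof (rule sum.cong[OF refl])
    fix D assume D: "D \<in> ?D"
    have N: "?N > 0" using m by simp
    have D2: "2 * D dvd ?N" using D dvd_mult_cancel_left[of 2 D "2 * int m"] by simp
    have "card (?Q D) = 2 ^ card {1..m} * fact (card {1..m})"
    proof (rule card_transversals)
      show "card (stripes ?N D) = 2 * card {1..m}" using card_stripes[OF N D2] by simp
      show "?M + D - x \<in> stripes ?N D" if "x \<in> stripes ?N D" for x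
        using stripes_reflect[OF N D2 that] .
      show "?M + D - x \<noteq> x" if "x \<in> stripes ?N D" for x
        using stripes_reflect_neq[of "int m" D x] m D that by simp
    qed (simp_all add: finite_stripes)
    thus "card (?Q D) = 2 ^ m * fact m" by simp
  qed
  also have "\<dots> = 4 * card {d. d dvd m} * (2 ^ m * fact m)"
    using card_int_divisors_double_odd(2)[OF m(2)] by simp
  finally show ?thesis .
qed

theorem theorem5p3:
  fixes m :: nat
  assumes "m \<ge> 3" and "odd m"
  shows "card (kb_labelings m 4 // kb_equivalence m 4)
           = 2 ^ m * fact (m - 1) * card {d :: nat. d dvd m}"
proof -
  have m: "m \<ge> 2" "m \<ge> 1" using assms by auto
  \<comment> \<open>The class size \<open>4 * m\<close> cancels the factor 4 of the divisor count
    and one factor \<open>m\<close> of \<open>fact m\<close>.\<close>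
  have "4 * m * card (kb_labelings m 4 // kb_equivalence m 4)
      = 4 * card {d. d dvd m} * (2 ^ m * fact m)"
    using card_kb_quotient[OF m(2) kb_act_gens_labelings[OF m(1) assms(2)]]
      card_kb_labelings_4[OF m(1) assms(2)] by simp
  also have "fact m = m * fact (m - 1)" using m by (simp add: fact_reduce)
  finally have "4 * m * card (kb_labelings m 4 // kb_equivalence m 4)
      = 4 * m * (2 ^ m * fact (m - 1) * card {d. d dvd m})" by (simp add: algebra_simps)
  thus ?thesis using m by simp
qed

end
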